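(* Let $|\Gamma_n^p|$ and $|\Delta_n^p|$ denote the determinants of the $(p,n)$-order Hankel matrices of the Cantor sequence $\mathbf{c}$ and of the sequence $\mathbf{d}$, $d_n=c_n+c_{n+2}$, respectively. For all integers $p\geq 0$ and $n\geq 2$, the following hold, where $=$ is equality of integers and $\equiv$ is congruence modulo $3$: (1) $|\Gamma_{3n}^{3p}|=(-1)^{n}|\Gamma_{n}^{p}|^{2}\cdot|\Delta_{n}^{p}|+(-1)^{n+1}|\Gamma_{n}^{p}|\cdot|\Gamma_{n+1}^{p}|\cdot|\Delta_{n-1}^{p}|$, (2) $|\Gamma_{3n+1}^{3p}|=(-1)^{n}|\Gamma_{n}^{p}|\cdot|\Gamma_{n+1}^{p}|\cdot|\Delta_{n}^{p}|+(-1)^{n+1}|\Gamma_{n+1}^{p}|^{2}\cdot|\Delta_{n-1}^{p}|$, (3) $|\Gamma_{3n+2}^{3p}|=(-1)^{n}|\Gamma_{n+1}^{p}|^{2}\cdot|\Delta_{n}^{p}|$, (4) $|\Gamma_{3n}^{3p+1}|=(-1)^{n}|\Gamma_{n}^{p}|\cdot|\Gamma_{n}^{p+1}|\cdot|\Delta_{n}^{p}|+(-1)^{n+1}|\Gamma_{n}^{p+1}|\cdot|\Gamma_{n+1}^{p}|\cdot|\Delta_{n-1}^{p}|$, (5) $|\Gamma_{3n+1}^{3p+1}|=(-1)^{n+1}|\Gamma_{n+1}^{p}|^{2}\cdot|\Delta_{n-1}^{p+1}|$, (6) $|\Gamma_{3n+2}^{3p+1}|=(-1)^{n+1}|\Gamma_{n+1}^{p}|^{2}\cdot|\Delta_{n}^{p+1}|$,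 (7) $|\Gamma_{3n}^{3p+2}|=(-1)^{n}|\Gamma_{n}^{p+1}|^{2}\cdot|\Delta_{n}^{p}|$, (8) $|\Gamma_{3n+1}^{3p+2}|=(-1)^{n}|\Gamma_{n}^{p+1}|\cdot|\Gamma_{n+1}^{p}|\cdot|\Delta_{n}^{p+1}|+(-1)^{n+1}|\Gamma_{n+1}^{p}|\cdot|\Gamma_{n+1}^{p+1}|\cdot|\Delta_{n-1}^{p+1}|$, (9) $|\Gamma_{3n+2}^{3p+2}|=(-1)^{n+1}|\Gamma_{n+1}^{p+1}|^{2}\cdot|\Delta_{n}^{p}|$, (10) $|\Delta_{3n}^{3p}|\equiv(-1)^{n}|\Gamma_{n}^{p}|\cdot|\Delta_{n}^{p}|^{2}+(-1)^{n+1}|\Gamma_{n+1}^{p}|\cdot|\Delta_{n-1}^{p}|\cdot|\Delta_{n}^{p}|$, (11) $|\Delta_{3n+1}^{3p}|\equiv(-1)^{n+1}|\Gamma_{n+1}^{p}|\cdot|\Delta_{n}^{p}|^{2}$, (12) $|\Delta_{3n+2}^{3p}|\equiv(-1)^{n}|\Gamma_{n+2}^{p}|\cdot|\Delta_{n}^{p}|^{2}+(-1)^{n+1}|\Gamma_{n+1}^{p}|\cdot|\Delta_{n}^{p}|\cdot|\Delta_{n+1}^{p}|$, (13) $|\Delta_{3n}^{3p+1}|\equiv(-1)^{n}|\Gamma_{n}^{p+1}|\cdot|\Delta_{n}^{p}|^{2}$, (14) $|\Delta_{3n+1}^{3p+1}|\equiv(-1)^{n}|\Gamma_{n+1}^{p+1}|\cdot|\Delta_{n}^{p}|^{2}$,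 (15) $|\Delta_{3n+2}^{3p+1}|\equiv(-1)^{n}|\Gamma_{n+2}^{p}|\cdot|\Delta_{n}^{p}|\cdot|\Delta_{n}^{p+1}|+(-1)^{n+1}|\Gamma_{n+1}^{p}|\cdot|\Delta_{n}^{p+1}|\cdot|\Delta_{n+1}^{p}|$, (16) $|\Delta_{3n}^{3p+2}|\equiv(-1)^{n}|\Gamma_{n}^{p+1}|\cdot|\Delta_{n}^{p}|\cdot|\Delta_{n}^{p+1}|+(-1)^{n+1}|\Gamma_{n+1}^{p+1}|\cdot|\Delta_{n}^{p}|\cdot|\Delta_{n-1}^{p+1}|$, (17) $|\Delta_{3n+1}^{3p+2}|\equiv(-1)^{n}|\Gamma_{n+1}^{p}|\cdot|\Delta_{n}^{p+1}|^{2}$, (18) $|\Delta_{3n+2}^{3p+2}|\equiv(-1)^{n}|\Gamma_{n+2}^{p}|\cdot|\Delta_{n}^{p+1}|^{2}$.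
   Context: The Cantor sequence $\mathbf{c}=(c_n)_{n\ge 0}\in\{0,1\}^{\mathbb{N}}$ is defined by $c_0=1$, $c_{3n}=c_n$, $c_{3n+1}=0$, $c_{3n+2}=c_n$ for $n\ge 0$ (equivalently, $c_n=1$ if the base-$3$ expansion of $n$ contains no digit $1$, and $c_n=0$ otherwise). The sequence $\mathbf{d}=(d_n)_{n\geq 0}$ is defined by $d_n=c_n+c_{n+2}$. For $n\ge 1$, $p\ge 0$, the $(p,n)$-order Hankel matrices are the $n\times n$ integer matrices $\Gamma_n^p=(c_{p+i+j-2})_{1\le i,j\le n}$ and $\Delta_n^p=(d_{p+i+j-2})_{1\le i,j\le n}$. $|M|$ denotes the determinant of a square matrix $M$. *)

theory Defs
  imports "Jordan_Normal_Form.Determinant" "HOL-Number_Theory.Cong"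
begin

(* c(0) = 1, c(3n) = c(n), c(3n+1) = 0, c(3n+2) = c(n); the clauses for 3n, 3n+1, 3n+2
   are merged into one equation and recovered by the lemmas below. *)
fun cantor :: "nat \<Rightarrow> int" where
  "cantor n = (if n = 0 then 1 else if n mod 3 = 1 then 0 else cantor (n div 3))"

declare cantor.simps [simp del]

lemma cantor_0: "cantor 0 = 1"
  by (simp add: cantor.simps)

lemma cantor_3n: "cantor (3 * n) = cantor n"
  by (cases "n = 0") (simp_all add: cantor.simps [of "3 * n"])

lemma cantor_3n1: "cantor (3 * n + 1) = 0"
proof -
  have "(3 * n + 1) mod 3 = 1" by presburger
  then show ?thesis by (subst cantor.simps) simp
qed

lemma cantor_3n2: "cantor (3 * n + 2) = cantor n"
proof -
  have "(3 * n + 2) mod 3 = 2" "(3 * n + 2) div 3 = n" by presburger+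
  then show ?thesis by (subst cantor.simps) simp
qed

definition d_seq :: "nat \<Rightarrow> int" where
  "d_seq n = cantor n + cantor (n + 2)"

(* Matrix indices start at 0 here, so the entry s(p+i+j-2) with 1 \<le> i, j \<le> n
   becomes s(p+i+j) with 0 \<le> i, j < n. The offset p (the paper's superscript) comes
   first, the size n (the subscript) second. *)
definition hankel :: "(nat \<Rightarrow> int) \<Rightarrow> nat \<Rightarrow> nat \<Rightarrow> int mat" where
  "hankel s p n = mat n n (\<lambda>(i, j). s (p + i + j))"

definition \<Gamma> :: "nat \<Rightarrow> nat \<Rightarrow> int mat" where
  "\<Gamma> p n = hankel cantor p n"

definition \<Delta> :: "nat \<Rightarrow> nat \<Rightarrow> int mat" where
  "\<Delta> p n = hankel d_seq p n"

end

(* Up to the shift by p, a Hankel determinant is the Gram determinant of 1, x, ..., x^(n-1) under the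
   bilinear form (P, Q) |-> L(P * Q), where L sends x^i to the i-th term of the sequence.  Sorting the
   monomials by their exponent modulo 3 turns the form of the tripled sequence into a 3 x 3 block form
   whose blocks are shifts of the Cantor Hankel matrix.  Adding monomials to other monomials (such as
   x^(3a+2) - x^(3a) - x^(3a+4)) makes these blocks orthogonal or isotropic, up to one boundary vector.
   That vector is a sum u + v of two orthogonal parts which each extend one of two orthogonal
   families, and expanding the determinant in it produces the formulas with two terms.
   For the determinants of d everything is done with a sequence congruent to d modulo 3. *)
theory Submission
  imports Defs
begin

section \<open>Gram determinants\<close>

text \<open>Row and column vectors come from separate lists because the off-diagonal blocks of a
  Gram matrix pair two different families.\<close>

definition gram :: "('v \<Rightarrow> 'w \<Rightarrow> 'a::comm_ring_1) \<Rightarrow> 'v list \<Rightarrow> 'w list \<Rightarrow> 'a" where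
  "gram B xs ys = det (mat (length xs) (length xs) (\<lambda>(i, j). B (xs ! i) (ys ! j)))"

lemma gram_cong:
  assumes "length xs' = length xs"
    and "\<And>i j. i < length xs \<Longrightarrow> j < length xs \<Longrightarrow> B (xs ! i) (ys ! j)
        = B' (xs' ! i) (ys' ! j)"
  shows "gram B xs ys = gram B' xs' ys'"
  unfolding gram_def using assms by (intro arg_cong[of _ _ det] eq_matI) auto

lemma gram_flip:
  assumes "length xs = length ys"
  shows "gram B xs ys = gram (\<lambda>y x. B x y) ys xs"
proof -
  let ?M = "mat (length xs) (length xs) (\<lambda>(i, j). B (xs ! i) (ys ! j))"
  have "det ?M = det (transpose_mat ?M)"
    by (rule det_transpose[symmetric, of _ "length xs"]) simp
  also have "transpose_mat ?M = mat (length ys) (length ys) (\<lambda>(i, j). B (xs ! j) (ys ! i))"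
    using assms by (intro eq_matI) auto
  finally show ?thesis by (simp add: gram_def)
qed

text \<open>Rows and columns undergo the same permutation, so its sign enters twice and cancels.
  Hence vectors may be reordered freely below.\<close>

lemma gram_permute:
  assumes "mset xs = mset ys"
  shows "gram B xs xs = gram B ys ys"
proof -
  obtain p where p: "p permutes {..<length ys}" "permute_list p ys = xs"
    using mset_eq_permutation[OF assms] by blast
  let ?n = "length ys"
  let ?A = "mat ?n ?n (\<lambda>(i, j). B (ys ! i) (ys ! j))"
  let ?A1 = "mat ?n ?n (\<lambda>(i, j). B (ys ! i) (ys ! p j))"
  have p': "p permutes {0..<?n}" using p(1) by (simp add: atLeast0LessThan)
  have lt: "i < ?n \<Longrightarrow> p i < ?n" for i using permutes_in_image[OF p(1), of i] by simp
  have len: "length xs = ?n" using p(2) by auto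
  have nth: "i < ?n \<Longrightarrow> xs ! i = ys ! p i" for i
    using permute_list_nth[OF p(1)] p(2) by metis
  have "det (mat ?n ?n (\<lambda>(i, j). B (ys ! p i) (ys ! p j)))
      = det (mat ?n ?n (\<lambda>(i, j). ?A1 $$ (p i, j)))"
    by (intro arg_cong[of _ _ det] eq_matI) (auto simp: lt)
  also have "\<dots> = signof p * det ?A1" by (rule det_permute_rows[OF _ p']) simp
  also have "det ?A1 = det (transpose_mat ?A1)" by (rule det_transpose[symmetric, of _ ?n]) simp
  also have "transpose_mat ?A1 = mat ?n ?n (\<lambda>(i, j). transpose_mat ?A $$ (p i, j))"
    by (intro eq_matI) (auto simp: lt)
  also have "det \<dots> = signof p * det (transpose_mat ?A)"
    by (rule det_permute_rows[OF _ p']) simp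
  also have "det (transpose_mat ?A) = det ?A" by (rule det_transpose[of _ ?n]) simp
  also have "signof p * (signof p * det ?A) = det ?A"
    by (simp add: sign_def)
  also have "det (mat ?n ?n (\<lambda>(i, j). B (ys ! p i) (ys ! p j))) = gram B xs xs"
    unfolding gram_def len by (intro arg_cong[of _ _ det] eq_matI) (auto simp: nth)
  finally show ?thesis by (simp add: gram_def)
qed

text \<open>Moving one block of rows past the other takes \<open>length xs * length ys\<close>
  transpositions.\<close>

lemma gram_swap_rows:
  assumes "length ws = length xs + length ys + length zs"
  shows "gram B (xs @ ys @ zs) ws = (-1) ^ (length xs * length ys) * gram B (ys @ xs @ zs) ws"
proof -
  let ?m = "length xs + (length ys + length zs)"
  have eq: "gram B (xs @ ys @ zs) ws
      = det (mat ?m ?m (\<lambda>(i, j). B ((xs @ ys @ zs) ! i) (ws ! j)))"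
    by (simp add: gram_def)
  show ?thesis unfolding eq
    apply (subst det_swap_initial_rows[of _ ?m "length xs" "length ys"])
    apply simp
    apply simp
    unfolding gram_def
    apply (intro arg_cong2[of _ _ _ _ "\<lambda>x y. (-1) ^ x * det y"] refl eq_matI)
    apply (auto simp: nth_append intro!: arg_cong[of _ _ "\<lambda>x. B x _"] arg_cong[of _ _ "(!) zs"])
    done
qed

lemma gram_swap_cols:
  assumes "length ws = length xs + length ys + length zs"
  shows "gram B ws (xs @ ys @ zs) = (-1) ^ (length xs * length ys) * gram B ws (ys @ xs @ zs)"
  using assms gram_swap_rows[OF assms, of "\<lambda>y x. B x y"] 
  by (simp add: gram_flip[of ws])

lemma gram_append_matrix:
  "gram B (xs @ ys) (xs' @ ys') = det (four_block_mat
     (mat (length xs) (length xs) (\<lambda>(i, j). B (xs ! i) (xs' ! j)))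
     (mat (length xs) (length ys) (\<lambda>(i, j). B (xs ! i) (ys' ! j)))
     (mat (length ys) (length xs) (\<lambda>(i, j). B (ys ! i) (xs' ! j)))
     (mat (length ys) (length ys) (\<lambda>(i, j). B (ys ! i) (ys' ! j))))"
  if "length xs' = length xs"
  unfolding gram_def using that by (intro arg_cong[of _ _ det] eq_matI) (auto simp: nth_append)

lemma gram_append_upper_zero:
  fixes B :: "'v \<Rightarrow> 'w \<Rightarrow> 'a::idom"
  assumes "length xs' = length xs" "length ys' = length ys"
    and "\<And>x y. x \<in> set xs \<Longrightarrow> y \<in> set ys' \<Longrightarrow> B x y = 0"
  shows "gram B (xs @ ys) (xs' @ ys') = gram B xs xs' * gram B ys ys'"
  unfolding gram_append_matrix[OF assms(1)] gram_def[of _ xs] gram_def[of _ ys]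
  by (rule det_four_block_mat_upper_right_zero[where n = "length xs" and m = "length ys"])
     (use assms in \<open>auto intro!: eq_matI\<close>)

lemma gram_append_lower_zero:
  fixes B :: "'v \<Rightarrow> 'w \<Rightarrow> 'a::idom"
  assumes "length xs' = length xs" "length ys' = length ys"
    and "\<And>x y. x \<in> set xs' \<Longrightarrow> y \<in> set ys \<Longrightarrow> B y x = 0"
  shows "gram B (xs @ ys) (xs' @ ys') = gram B xs xs' * gram B ys ys'"
  using gram_append_upper_zero[of xs xs' ys ys' "\<lambda>y x. B x y"] assms
  by (simp add: gram_flip[of "xs @ ys"] gram_flip[of xs] gram_flip[of ys])

lemma gram_zero_row:
  assumes "z \<in> set xs" "length ys = length xs" "\<And>y. y \<in> set ys \<Longrightarrow> B z y = 0"
  shows "gram B xs ys = 0"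
proof -
  obtain k where k: "k < length xs" "xs ! k = z" using assms(1) by (auto simp: in_set_conv_nth)
  let ?M = "mat (length xs) (length xs) (\<lambda>(i, j). B (xs ! i) (ys ! j))"
  have "det ?M = (\<Sum>j<length xs. ?M $$ (k, j) * cofactor ?M k j)"
    by (rule laplace_expansion_row[of _ "length xs"]) (use k in auto)
  also have "\<dots> = 0" using k assms by (intro sum.neutral) auto
  finally show ?thesis by (simp add: gram_def)
qed

lemma gram_zero_col:
  assumes "z \<in> set ys" "length ys = length xs" "\<And>x. x \<in> set xs \<Longrightarrow> B x z = 0"
  shows "gram B xs ys = 0"
  using gram_zero_row[of z ys xs "\<lambda>y x. B x y"] assms by (simp add: gram_flip[of xs])

text \<open>Since \<open>xs\<close> is isotropic and orthogonal to \<open>zs\<close>, swapping the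
  column blocks of \<open>xs\<close> and \<open>ys\<close> makes the matrix block triangular. Its
  diagonal blocks are the pairing of \<open>xs\<close> with \<open>ys\<close>, the transpose of that
  pairing, and the Gram matrix of \<open>zs\<close>; the swap contributes the sign.\<close>

lemma gram_anti_block:
  fixes B :: "'v \<Rightarrow> 'v \<Rightarrow> 'a::idom"
  assumes sym: "\<And>x y. B x y = B y x"
    and len: "length xs = n" "length ys = n"
    and xx: "\<And>x x'. x \<in> set xs \<Longrightarrow> x' \<in> set xs \<Longrightarrow> B x x'
        = 0"
    and xz: "\<And>x z. x \<in> set xs \<Longrightarrow> z \<in> set zs \<Longrightarrow> B x z = 0"
  shows "gram B (xs @ ys @ zs) (xs @ ys @ zs) = (-1) ^ n * (gram B xs ys)\<^sup>2 * gram B zs zs"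
proof -
  have "gram B (xs @ ys @ zs) (xs @ ys @ zs)
      = (-1) ^ (n * n) * gram B (xs @ ys @ zs) (ys @ xs @ zs)"
    using gram_swap_cols[of "xs @ ys @ zs" xs ys zs B] len by simp
  also have "gram B (xs @ ys @ zs) (ys @ xs @ zs) = gram B xs ys * gram B (ys @ zs) (xs @ zs)"
    by (rule gram_append_upper_zero) (use len xx xz in auto)
  also have "gram B (ys @ zs) (xs @ zs) = gram B ys xs * gram B zs zs"
    by (rule gram_append_lower_zero) (use len xx xz sym in auto)
  also have "gram B ys xs = gram B xs ys"
    using len sym by (subst gram_flip) (auto intro!: gram_cong)
  also have "(-1::'a) ^ (n * n) = (-1) ^ n" by (simp add: minus_one_power_iff)
  finally show ?thesis by (simp add: power2_eq_square)
qed

lemma gram_add_row: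
  fixes B :: "'v::ab_group_add \<Rightarrow> 'w \<Rightarrow> 'a::comm_ring_1"
  assumes add: "\<And>x y z. B (x + y) z = B x z + B y z"
  shows "gram B (xs @ (u + v) # zs) ys = gram B (xs @ u # zs) ys + gram B (xs @ v # zs) ys"
proof -
  let ?k = "length xs" let ?n = "Suc (length xs + length zs)"
  let ?M = "\<lambda>w. mat ?n ?n (\<lambda>(i, j). B ((xs @ w # zs) ! i) (ys ! j))"
  have g: "gram B (xs @ w # zs) ys = det (?M w)" for w by (simp add: gram_def)
  \<comment> \<open>The cofactors along row \<open>?k\<close> do not see the vector in that row, so
    those of \<open>?M 0\<close> serve every \<open>w\<close>, and the determinant is visibly
    additive in \<open>w\<close>.\<close>
  have lap: "det (?M w) = (\<Sum>j<?n. B w (ys ! j) * cofactor (?M 0) ?k j)" for w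
  proof -
    have "det (?M w) = (\<Sum>j<?n. ?M w $$ (?k, j) * cofactor (?M w) ?k j)"
      by (rule laplace_expansion_row[of _ ?n]) auto
    moreover have "cofactor (?M w) ?k j = cofactor (?M 0) ?k j" for j
      unfolding cofactor_def mat_delete_def
      by (intro arg_cong[of _ _ "\<lambda>x. _ * det x"] eq_matI) (auto simp: nth_append)
    ultimately show ?thesis by (simp add: nth_append)
  qed
  show ?thesis unfolding g lap by (simp add: add sum.distrib algebra_simps)
qed


section \<open>Symmetric forms: simultaneous row and column operations\<close>

abbreviation gram1 :: "('v \<Rightarrow> 'v \<Rightarrow> 'a::comm_ring_1) \<Rightarrow> 'v list \<Rightarrow> 'a" where
  "gram1 B xs \<equiv> gram B xs xs"

lemma gram_repeated_row:
  assumes "z \<in> set xs"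
  shows "gram B (z # xs) ys = 0"
proof -
  obtain k where k: "k < length xs" "xs ! k = z" using assms by (auto simp: in_set_conv_nth)
  show ?thesis unfolding gram_def
    by (rule det_identical_rows[of _ "Suc (length xs)" 0 "Suc k"]) (use k in \<open>auto intro!: eq_vecI\<close>)
qed

text \<open>Vectors are only ever added, subtracted and negated, so additivity in each argument
  takes the place of bilinearity over a ring of scalars.\<close>

locale symmetric_biadditive =
  fixes B :: "'v::ab_group_add \<Rightarrow> 'v \<Rightarrow> 'a::idom"
  assumes add_left: "B (x + y) z = B x z + B y z"
    and sym: "B x y = B y x"
begin

lemma add_right: "B z (x + y) = B z x + B z y"
  using add_left sym by metis

lemma zero_left: "B 0 z = 0"
  using add_left[of 0 0 z] by (metis add.right_neutral add_left_cancel)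

lemma minus_left: "B (- x) z = - B x z"
  using add_left[of "- x" x z] by (simp add: zero_left eq_neg_iff_add_eq_0)

lemma minus_right: "B z (- x) = - B z x"
  using minus_left sym by metis

lemma diff_left: "B (x - y) z = B x z - B y z"
  using add_left[of x "- y" z] by (simp add: minus_left)

lemma diff_right: "B z (x - y) = B z x - B z y"
  using diff_left sym by metis

lemmas bilinear_simps = add_left add_right diff_left diff_right minus_left minus_right

lemma gram_flip_sym: "length xs = length ys \<Longrightarrow> gram B xs ys = gram B ys xs"
  using sym by (subst gram_flip) (auto intro: gram_cong)

lemma gram_add_col:
  assumes "length ys = Suc (length xs + length zs)"
  shows "gram B ys (xs @ (u + v) # zs) = gram B ys (xs @ u # zs) + gram B ys (xs @ v # zs)"
  using assms gram_add_row[of B, OF add_left, of xs u v zs ys] by (simp add: gram_flip_sym[of ys])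

lemma gram_minus_row: "gram B (xs @ (- u) # zs) ys = - gram B (xs @ u # zs) ys"
  if "length ys = Suc (length xs + length zs)"
proof -
  have "gram B (xs @ (u + - u) # zs) ys = 0"
    by (rule gram_zero_row[of 0]) (use that in \<open>auto simp: zero_left\<close>)
  then show ?thesis unfolding gram_add_row[of B, OF add_left] by (simp add: eq_neg_iff_add_eq_0 add.commute)
qed

lemma gram_minus_rows:
  assumes "length zs = length xs + length ys"
  shows "gram B (xs @ map uminus ys) zs = (-1) ^ length ys * gram B (xs @ ys) zs"
  using assms
proof (induction ys arbitrary: xs)
  case (Cons y ys)
  then have "gram B ((xs @ [- y]) @ map uminus ys) zs = (-1) ^ length ys * gram B ((xs @ [- y]) @ ys) zs"
    by (intro Cons.IH) simp
  with gram_minus_row[of zs xs ys y] Cons.prems show ?case by simp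
qed simp

lemma gram_minus: "gram1 B (xs @ (- u) # zs) = gram1 B (xs @ u # zs)"
  using gram_minus_row[of "xs @ (- u) # zs" xs zs u] gram_minus_row[of "xs @ u # zs" xs zs u]
  by (simp add: gram_flip_sym[of "xs @ u # zs" "xs @ (- u) # zs"])

text \<open>A row operation followed by the same column operation; the additional term of each has a
  repeated row or column.\<close>

lemma gram_add_member:
  assumes "z \<in> set xs"
  shows "gram1 B ((x + z) # xs) = gram1 B (x # xs)"
proof -
  have row: "gram B ((x + z) # xs) ys = gram B (x # xs) ys" for ys
    using gram_add_row[of B, OF add_left, of "[]" x z xs ys] gram_repeated_row[OF assms, of B ys]
    by simp
  have "gram1 B ((x + z) # xs) = gram B ((x + z) # xs) (x # xs)"
    unfolding row by (subst (1 2) gram_flip_sym) (simp_all add: row)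
  then show ?thesis by (simp add: row)
qed

text \<open>The correcting vectors lie in \<open>xs\<close>, which stays fixed, so the corrections
  can be made one after another. This is the tool for clearing blocks.\<close>

lemma gram_shift:
  assumes "\<And>i. i \<in> set is \<Longrightarrow> \<exists>z\<in>set xs. g i = f i + z \<or> g i = f i - z"
  shows "gram1 B (xs @ map f is) = gram1 B (xs @ map g is)"
  using assms
proof (induction "is" arbitrary: xs)
  case Nil
  then show ?case by simp
next
  case (Cons i "is")
  \<comment> \<open>The case of subtraction is an addition read from right to left.\<close>
  then obtain z where z: "z \<in> set xs" "g i = f i + z \<or> f i = g i + z"
    by (metis diff_add_cancel list.set_intros(1))
  let ?r = "xs @ map f is"
  have "z \<in> set ?r" using z by simp
  then have "gram1 B (f i # ?r) = gram1 B (g i # ?r)"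
    using z(2) gram_add_member by metis
  \<comment> \<open>The finished vector \<open>g i\<close> joins the fixed part, which the induction
    leaves arbitrary.\<close>
  moreover have "gram1 B ((xs @ [g i]) @ map f is) = gram1 B ((xs @ [g i]) @ map g is)"
    using Cons.prems by (intro Cons.IH) auto
  moreover have "gram1 B (xs @ map f (i # is)) = gram1 B (f i # ?r)"
    and "gram1 B ((xs @ [g i]) @ map f is) = gram1 B (g i # ?r)"
    by (intro gram_permute; simp)+
  ultimately show ?case by simp
qed

lemma gram_orthogonal:
  assumes "\<And>x y. x \<in> set xs \<Longrightarrow> y \<in> set ys \<Longrightarrow> B x y = 0"
  shows "gram1 B (xs @ ys) = gram1 B xs * gram1 B ys"
  using assms by (intro gram_append_upper_zero) auto

text \<open>Expanding both the row and the column of \<open>u + v\<close> gives four terms. The two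
  pure ones split by orthogonality, \<open>u\<close> prolonging \<open>xs\<close> and
  \<open>v\<close> prolonging \<open>ys\<close>; the two mixed ones vanish.\<close>

lemma gram_glue:
  assumes xs: "\<And>x y. x \<in> set (xs @ [u]) \<Longrightarrow> y \<in> set (ys @ [v]) \<Longrightarrow> B x y = 0"
  shows "gram1 B (xs @ (u + v) # ys)
    = gram1 B (xs @ [u]) * gram1 B ys + gram1 B xs * gram1 B (v # ys)"
proof -
  let ?g = "\<lambda>r c. gram B (xs @ r # ys) (xs @ c # ys)"
  have uu: "?g u u = gram1 B (xs @ [u]) * gram1 B ys"
    using gram_orthogonal[of "xs @ [u]" ys] xs by simp
  have vv: "?g v v = gram1 B xs * gram1 B (v # ys)"
    using gram_orthogonal[of xs "v # ys"] xs by simp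
  have "gram B ((xs @ [u]) @ ys) ((xs @ [v]) @ ys) = gram B (xs @ [u]) (xs @ [v]) * gram1 B ys"
    by (rule gram_append_upper_zero) (use xs in auto)
  \<comment> \<open>The column of \<open>v\<close> is orthogonal to every row of this block.\<close>
  also have "gram B (xs @ [u]) (xs @ [v]) = 0"
    by (rule gram_zero_col[of v]) (use xs in auto)
  finally have uv: "?g u v = 0" by simp
  then have vu: "?g v u = 0" by (subst gram_flip_sym) auto
  show ?thesis
    by (simp add: gram_add_row[of B, OF add_left] gram_add_col uu vv uv vu)
qed

end

text \<open>The factor \<open>c\<close> absorbs signs. The bounds on \<open>a\<close> and
  \<open>b\<close> admit families that follow the Hankel pattern only up to a substituted last
  vector.\<close>

lemma gram_hankel:
  assumes "\<And>a b. a < n \<Longrightarrow> b < n \<Longrightarrow> B (f a) (g b) = c * s (q + a + b)"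
  shows "gram B (map f [0..<n]) (map g [0..<n]) = c ^ n * det (hankel s q n)"
proof -
  have "gram B (map f [0..<n]) (map g [0..<n]) = det (c \<cdot>\<^sub>m hankel s q n)"
    unfolding gram_def hankel_def using assms
    by (intro arg_cong[of _ _ det] eq_matI) auto
  then show ?thesis by (simp add: hankel_def)
qed

section \<open>Hankel determinants as Gram determinants\<close>

definition moment :: "(nat \<Rightarrow> int) \<Rightarrow> int poly \<Rightarrow> int" where
  "moment s p = (\<Sum>i\<le>degree p. coeff p i * s i)"

text \<open>A common upper bound lets polynomials of different degrees be summed over one range,
  which gives additivity.\<close>

lemma moment_eq_sum:
  assumes "degree p \<le> N"
  shows "moment s p = (\<Sum>i\<le>N. coeff p i * s i)"
  unfolding moment_def using assms
  by (intro sum.mono_neutral_left) (auto simp: coeff_eq_0)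

lemma moment_add: "moment s (p + q) = moment s p + moment s q"
proof -
  let ?N = "max (degree p) (degree q)"
  have "degree (p + q) \<le> ?N" by (rule degree_add_le_max)
  then show ?thesis
    by (simp add: moment_eq_sum[of _ ?N] sum.distrib algebra_simps)
qed

lemma moment_monom: "moment s (monom 1 k) = s k"
  by (simp add: moment_def degree_monom_eq if_distrib[of "\<lambda>x. x * _"] cong: if_cong)

text \<open>The offset is split as \<open>3 * p + k\<close>: the residue \<open>k\<close> decides
  which blocks occur, while \<open>p\<close> becomes their offset.\<close>

definition hankel_form :: "(nat \<Rightarrow> int) \<Rightarrow> nat \<Rightarrow> nat \<Rightarrow> int poly \<Rightarrow> int poly \<Rightarrow> int" where
  "hankel_form s p k P Q = moment (\<lambda>i. s (3 * p + k + i)) (P * Q)"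

interpretation hankel_form: symmetric_biadditive "hankel_form s p k" for s p k
  by unfold_locales (simp_all add: hankel_form_def moment_add algebra_simps)

text \<open>The parameter \<open>k\<close> is not reduced modulo 3: it is the sum of three residues,
  one from the offset and two from the exponents, and so runs up to 6.\<close>

definition dilate :: "(nat \<Rightarrow> int) \<Rightarrow> nat \<Rightarrow> nat \<Rightarrow> int" where
  "dilate s k m = s (3 * m + k)"

definition xpow :: "nat \<Rightarrow> nat \<Rightarrow> int poly" where
  "xpow r a = monom 1 (3 * a + r)"

abbreviation xpows :: "nat \<Rightarrow> nat \<Rightarrow> int poly list" where
  "xpows r n \<equiv> map (xpow r) [0..<n]"

text \<open>The entry depends on \<open>a + b\<close> alone, so exponents of residues
  \<open>r\<close> and \<open>t\<close> span a Hankel block of the dilated sequence with offset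
  \<open>p\<close>.\<close>

lemma hankel_form_xpow: "hankel_form s p k (xpow r a) (xpow t b) = dilate s (k + r + t) (p + a + b)"
  by (simp add: hankel_form_def xpow_def dilate_def mult_monom moment_monom algebra_simps)

lemma mset_map_upt_triple:
  "mset (map f [0..<3 * n])
    = mset (map (\<lambda>a. f (3 * a)) [0..<n] @ map (\<lambda>a. f (3 * a + 1)) [0..<n] @ map (\<lambda>a. f (3 * a + 2)) [0..<n])"
proof (induction n)
  case (Suc n)
  have "3 * Suc n = Suc (Suc (Suc (3 * n)))" by simp
  with Suc show ?case by (simp del: mult_Suc_right)
qed simp

lemma hankel_eq_gram: "det (hankel s (3 * p + k) N) = gram1 (hankel_form s p k) (map (monom 1) [0..<N])"
  using gram_hankel[of N "hankel_form s p k" "monom 1" "monom 1" 1 s "3 * p + k"]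
  by (simp add: hankel_form_def mult_monom moment_monom add.assoc)

text \<open>In sizes \<open>3 * n + 1\<close> and \<open>3 * n + 2\<close> the surplus exponents are
  \<open>3 * n\<close> and \<open>3 * n + 1\<close>, so residue 0 gains a member first and residue 1
  next.\<close>

lemma hankel_blocks:
  "det (hankel s (3 * p + k) (3 * n)) = gram1 (hankel_form s p k) (xpows 0 n @ xpows 1 n @ xpows 2 n)"
  "det (hankel s (3 * p + k) (3 * n + 1)) = gram1 (hankel_form s p k) (xpows 0 (n + 1) @ xpows 1 n @ xpows 2 n)"
  "det (hankel s (3 * p + k) (3 * n + 2)) = gram1 (hankel_form s p k) (xpows 0 (n + 1) @ xpows 1 (n + 1) @ xpows 2 n)"
  unfolding hankel_eq_gram
  by (intro gram_permute; use mset_map_upt_triple[of "monom 1 :: nat \<Rightarrow> int poly" n] in \<open>simp add: xpow_def[abs_def]\<close>)+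

section \<open>The two sequences on residue classes modulo 3\<close>

lemma dilate_cantor:
  "dilate cantor 0 m = cantor m" "dilate cantor 1 m = 0" "dilate cantor (Suc 0) m = 0" "dilate cantor 2 m = cantor m"
  "dilate cantor 3 m = cantor (Suc m)" "dilate cantor 4 m = 0" "dilate cantor 5 m = cantor (Suc m)"
  "dilate cantor 6 m = cantor (Suc (Suc m))"
  using cantor_3n[of m] cantor_3n1[of m] cantor_3n2[of m]
    cantor_3n[of "Suc m"] cantor_3n1[of "Suc m"] cantor_3n2[of "Suc m"] cantor_3n[of "Suc (Suc m)"]
  by (simp_all add: dilate_def eval_nat_numeral)

text \<open>On residues 1 and 2 this is \<open>d_seq\<close> itself; on residue 0 the value 2 c_m of
  \<open>d_seq\<close> is replaced by - c_m. With all coefficients equal to 1 or -1, blocks can be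
  cleared by adding and subtracting vectors.\<close>

definition d_mod3 :: "nat \<Rightarrow> int" where
  "d_mod3 n = (if n mod 3 = 0 then - cantor (n div 3)
           else if n mod 3 = 1 then cantor (n div 3 + 1) else cantor (n div 3))"

lemma d_mod3_triple:
  "d_mod3 (3 * m) = - cantor m" "d_mod3 (3 * m + 1) = cantor (Suc m)" "d_mod3 (3 * m + 2) = cantor m"
proof -
  have "(3 * m + 1) mod 3 = 1" "(3 * m + 1) div 3 = m"
    "(3 * m + 2) mod 3 = 2" "(3 * m + 2) div 3 = m" by presburger+
  then show "d_mod3 (3 * m) = - cantor m" "d_mod3 (3 * m + 1) = cantor (Suc m)" "d_mod3 (3 * m + 2) = cantor m"
    by (simp_all add: d_mod3_def)
qed

lemma dilate_d_mod3:
  "dilate d_mod3 0 m = - cantor m" "dilate d_mod3 1 m = cantor (Suc m)" "dilate d_mod3 (Suc 0) m = cantor (Suc m)"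
  "dilate d_mod3 2 m = cantor m"
  "dilate d_mod3 3 m = - cantor (Suc m)" "dilate d_mod3 4 m = cantor (Suc (Suc m))" "dilate d_mod3 5 m = cantor (Suc m)"
  "dilate d_mod3 6 m = - cantor (Suc (Suc m))"
  using d_mod3_triple[of m] d_mod3_triple[of "Suc m"] d_mod3_triple[of "Suc (Suc m)"]
  by (simp_all add: dilate_def eval_nat_numeral)

lemma d_seq_cong_d_mod3: "[d_seq n = d_mod3 n] (mod 3)"
proof -
  have "\<exists>m. n = 3 * m \<or> n = 3 * m + 1 \<or> n = 3 * m + 2"
    by presburger
  then obtain m where "n = 3 * m \<or> n = 3 * m + 1 \<or> n = 3 * m + 2"
    by blast
  then consider "n = 3 * m" | "n = 3 * m + 1" | "n = 3 * m + 2"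
    by blast
  then show ?thesis
  proof cases
    case 1
    then show ?thesis using cantor_3n2[of m]
      by (simp add: d_seq_def d_mod3_triple cantor_3n cong_iff_dvd_diff)
  next
    case 2
    then show ?thesis using cantor_3n1[of m] cantor_3n[of "Suc m"] d_mod3_triple(2)[of m]
      by (simp add: d_seq_def eval_nat_numeral)
  next
    case 3
    then show ?thesis using cantor_3n2[of m] cantor_3n1[of "Suc m"] d_mod3_triple(3)[of m]
      by (simp add: d_seq_def eval_nat_numeral)
  qed
qed

text \<open>A determinant is a polynomial with integer coefficients in its entries.\<close>

lemma det_hankel_cong:
  assumes "\<And>k. [s k = t k] (mod m)"
  shows "[det (hankel s p n) = det (hankel t p n)] (mod m)"
  unfolding det_def hankel_def using assms
  by (auto intro!: cong_sum cong_mult cong_prod simp: permutes_in_image)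

section \<open>The block forms\<close>

lemmas entry_simps = hankel_form.bilinear_simps hankel_form_xpow dilate_cantor dilate_d_mod3 d_seq_def numeral_2_eq_2[symmetric]

text \<open>The determinant of the block matrix with rows \<open>(G, G')\<close> and \<open>(G', - G)\<close>, where \<open>G\<close> and \<open>G'\<close>
  are the Hankel matrices of order \<open>Suc m\<close> with offsets \<open>p\<close> and \<open>p + 1\<close>.\<close>
definition block_pair :: "nat \<Rightarrow> nat \<Rightarrow> int" where
  "block_pair p m = (-1) ^ Suc m * (det (\<Gamma> p (Suc m)) * det (\<Delta> p (Suc m)) - det (\<Gamma> p (Suc (Suc m))) * det (\<Delta> p m))"

lemma gram_eq_Gamma:
  assumes "\<And>a b. B (f a) (g b) = cantor (p + a + b)"
  shows "gram B (map f [0..<n]) (map g [0..<n]) = det (\<Gamma> p n)"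
  using gram_hankel[of n B f g 1 cantor p] assms by (simp add: \<Gamma>_def)

lemma gram_eq_Delta:
  assumes "\<And>a b. B (f a) (g b) = d_seq (p + a + b)"
  shows "gram B (map f [0..<n]) (map g [0..<n]) = det (\<Delta> p n)"
  using gram_hankel[of n B f g 1 d_seq p] assms by (simp add: \<Delta>_def)

text \<open>A realization of the matrix by polynomials, in which the orthogonalizing vectors can be
  written down. Any other family with the same entries then has the same determinant.\<close>

lemma gram_block_pair_model:
  fixes p m :: nat
  defines "B \<equiv> hankel_form cantor p 0" and "q \<equiv> \<lambda>a. xpow 2 a - xpow 0 a"
  shows "gram1 B (xpows 1 (Suc m) @ map q [0..<Suc m])
    = block_pair p m"
proof -
  \<comment> \<open>Subtracting \<open>xpow 1 (Suc a)\<close> makes \<open>q a\<close> orthogonal to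
    the family \<open>xpow 1\<close> and turns the block \<open>- G\<close> into the negative of a
    Hankel block of \<open>d_seq\<close>.\<close>
  define w where "w a = q a - xpow 1 (Suc a)" for a
  have q_m: "q m = xpow 1 (Suc m) + w m" by (simp add: w_def)
  have W: "gram1 B (map w [0..<k]) = (-1) ^ k * det (\<Delta> p k)" for k
    unfolding \<Delta>_def
    by (rule gram_hankel) (simp add: w_def q_def B_def entry_simps)
  have E1: "gram1 B (xpows 1 k) = det (\<Gamma> p k)" for k
    by (rule gram_eq_Gamma) (simp add: B_def entry_simps)
  have orth: "B (xpow 1 a) (w b) = 0" for a b
    by (simp add: w_def q_def B_def entry_simps)
  have "gram1 B (xpows 1 (Suc m) @ map q [0..<Suc m])
      = gram1 B ((xpows 1 (Suc m) @ [q m]) @ map q [0..<m])"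
    by (rule gram_permute) simp
  \<comment> \<open>For \<open>a < m\<close> the vector \<open>xpow 1 (Suc a)\<close> is in the
    list, but \<open>xpow 1 (Suc m)\<close> is not. Hence \<open>q m\<close> is set aside as the
    boundary vector and glued.\<close>
  also have "\<dots> = gram1 B ((xpows 1 (Suc m) @ [q m]) @ map w [0..<m])"
    unfolding B_def by (rule hankel_form.gram_shift) (auto simp: w_def bex_Un simp del: upt_Suc)
  also have "\<dots> = gram1 B (xpows 1 (Suc m) @ (xpow 1 (Suc m) + w m) # map w [0..<m])"
    by (simp add: q_m)
  also have "\<dots> = gram1 B (xpows 1 (Suc m) @ [xpow 1 (Suc m)]) * gram1 B (map w [0..<m])
      + gram1 B (xpows 1 (Suc m)) * gram1 B (w m # map w [0..<m])"
    unfolding B_def by (rule hankel_form.gram_glue) (use orth in \<open>auto simp: B_def\<close>)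
  also have "gram1 B (w m # map w [0..<m]) = gram1 B (map w [0..<Suc m])"
    by (rule gram_permute) simp
  also have "xpows 1 (Suc m) @ [xpow 1 (Suc m)] = xpows 1 (Suc (Suc m))" by simp
  finally show ?thesis unfolding W E1 block_pair_def by (simp add: algebra_simps)
qed

lemma gram_map_append:
  assumes "\<And>a b. a < n \<Longrightarrow> b < n \<Longrightarrow> B (f a) (h b) = B' (f' a) (h' b)"
    and "\<And>a b. a < n \<Longrightarrow> b < m \<Longrightarrow> B (f a) (k b)
        = B' (f' a) (k' b)"
    and "\<And>a b. a < m \<Longrightarrow> b < n \<Longrightarrow> B (g a) (h b)
        = B' (g' a) (h' b)"
    and "\<And>a b. a < m \<Longrightarrow> b < m \<Longrightarrow> B (g a) (k b)
        = B' (g' a) (k' b)"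
  shows "gram B (map f [0..<n] @ map g [0..<m]) (map h [0..<n] @ map k [0..<m])
    = gram B' (map f' [0..<n] @ map g' [0..<m]) (map h' [0..<n] @ map k' [0..<m])"
  by (rule gram_cong) (use assms in \<open>auto simp: nth_append\<close>)

lemma gram_block_pair:
  assumes "\<And>a b. B (f a) (f b) = cantor (p + a + b)" "\<And>a b. B (f a) (g b) = cantor (p + a + b + 1)"
    and "\<And>a b. B (g a) (f b)
        = cantor (p + a + b + 1)" "\<And>a b. B (g a) (g b) = - cantor (p + a + b)"
  shows "gram1 B (map f [0..<Suc m] @ map g [0..<Suc m])
    = block_pair p m"
  unfolding gram_block_pair_model[symmetric]
  by (rule gram_map_append) (simp_all add: assms entry_simps)

text \<open>Here the rows are \<open>(G', G)\<close> and \<open>(G, - G')\<close>. Exchanging the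
  block rows after reordering the families, and negating one of them, gives the previous matrix; the
  two operations have the same sign, which cancels.\<close>

lemma gram_block_pair_rotated:
  assumes B: "symmetric_biadditive B"
    and "\<And>a b. B (f a) (f b)
        = cantor (p + a + b + 1)" "\<And>a b. B (f a) (g b) = cantor (p + a + b)"
    and "\<And>a b. B (g a) (f b)
        = cantor (p + a + b)" "\<And>a b. B (g a) (g b) = - cantor (p + a + b + 1)"
  shows "gram1 B (map f [0..<Suc m] @ map g [0..<Suc m])
    = block_pair p m"
proof -
  interpret symmetric_biadditive B by (rule B)
  let ?F = "map f [0..<Suc m]" and ?G = "map g [0..<Suc m]"
  have "gram1 B (?F @ ?G) = gram1 B (?G @ ?F)" by (rule gram_permute) simp
  also have "\<dots> = (-1) ^ (Suc m * Suc m) * gram B (?F @ ?G) (?G @ ?F)"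
    using gram_swap_rows[of "?G @ ?F" ?G ?F "[]" B] by simp
  also have "gram B (?F @ ?G) (?G @ ?F)
      = (-1) ^ Suc m * gram B (?F @ map (\<lambda>a. - g a) [0..<Suc m]) (?G @ ?F)"
    using gram_minus_rows[of "?G @ ?F" ?F ?G] by (simp add: comp_def flip: power_add)
  also have "gram B (?F @ map (\<lambda>a. - g a) [0..<Suc m]) (?G @ ?F)
      = gram1 (hankel_form cantor p 0) (xpows 1 (Suc m) @ map (\<lambda>a. xpow 2 a - xpow 0 a) [0..<Suc m])"
    by (rule gram_map_append)
      (simp_all add: assms minus_left entry_simps)
  also note gram_block_pair_model
  also have "(-1 :: int) ^ (Suc m * Suc m) = (-1) ^ Suc m"
    by (simp only: minus_one_power_iff even_mult_iff) simp
  finally show ?thesis unfolding minus_one_power_iff by (simp split: if_splits)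
qed


section \<open>Cantor Gram determinants for the three residues of the offset\<close>

lemma Gamma_0_grams:
  fixes p n m :: nat
  defines "B \<equiv> hankel_form cantor p 0"
  shows "Suc m \<le> n \<Longrightarrow> gram1 B (xpows 0 n @ xpows 1 (Suc m) @ xpows 2 (Suc m))
      = det (\<Gamma> p n) * block_pair p m"
    and "gram1 B (xpows 0 (n + 1) @ xpows 1 (n + 1) @ xpows 2 n)
        = (-1) ^ n * (det (\<Gamma> p (n + 1)))\<^sup>2 * det (\<Delta> p n)"
proof -
  \<comment> \<open>The blocks of residues (0, 0) and (0, 2) agree, so \<open>q a\<close> is
    orthogonal to the family \<open>xpow 0\<close>; that of residues (0, 1) is zero.\<close>
  define q where "q a = xpow 2 a - xpow 0 a" for a
  have q: "gram1 B (xpows 0 k @ xpows 1 l @ xpows 2 j)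
      = gram1 B (xpows 0 k @ xpows 1 l @ map q [0..<j])" if "j \<le> k" for j k l
  proof -
    have "gram1 B ((xpows 0 k @ xpows 1 l) @ xpows 2 j)
        = gram1 B ((xpows 0 k @ xpows 1 l) @ map q [0..<j])"
      unfolding B_def by (rule hankel_form.gram_shift) (use that in \<open>auto simp: q_def\<close>)
    then show ?thesis by simp
  qed
  show "gram1 B (xpows 0 n @ xpows 1 (Suc m) @ xpows 2 (Suc m))
      = det (\<Gamma> p n) * block_pair p m" if "Suc m \<le> n"
  proof -
    have "gram1 B (xpows 0 n @ xpows 1 (Suc m) @ xpows 2 (Suc m)) 
        = gram1 B (xpows 0 n) * gram1 B (xpows 1 (Suc m) @ map q [0..<Suc m])"
      unfolding q[OF that] unfolding B_def by (rule hankel_form.gram_orthogonal) (auto simp: q_def entry_simps)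
    also have "gram1 B (xpows 0 n) = det (\<Gamma> p n)"
      by (rule gram_eq_Gamma) (simp add: B_def entry_simps)
    also have "gram1 B (xpows 1 (Suc m) @ map q [0..<Suc m]) = block_pair p m"
      by (rule gram_block_pair) (simp_all add: B_def q_def entry_simps)
    finally show ?thesis .
  qed
  \<comment> \<open>With \<open>n + 1\<close> members of residue 1, every
    \<open>xpow 1 (Suc a)\<close> with \<open>a < n\<close> is available: no boundary vector
    remains, and the three families are pairwise orthogonal.\<close>
  define w where "w a = q a - xpow 1 (Suc a)" for a
  have "gram1 B (xpows 0 (n + 1) @ xpows 1 (n + 1) @ xpows 2 n)
      = gram1 B ((xpows 0 (n + 1) @ xpows 1 (n + 1)) @ map q [0..<n])"
    by (subst q) simp_all
  also have "\<dots> = gram1 B ((xpows 0 (n + 1) @ xpows 1 (n + 1)) @ map w [0..<n])"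
    unfolding B_def by (rule hankel_form.gram_shift) (auto simp: w_def bex_Un simp del: upt_Suc)
  also have "\<dots> = gram1 B (xpows 0 (n + 1) @ xpows 1 (n + 1)) * gram1 B (map w [0..<n])"
    unfolding B_def by (rule hankel_form.gram_orthogonal) (auto simp: w_def q_def entry_simps)
  also have "gram1 B (xpows 0 (n + 1) @ xpows 1 (n + 1))
      = gram1 B (xpows 0 (n + 1)) * gram1 B (xpows 1 (n + 1))"
    unfolding B_def by (rule hankel_form.gram_orthogonal) (auto simp: entry_simps)
  also have "gram1 B (xpows 0 (n + 1)) = det (\<Gamma> p (n + 1))"
    by (rule gram_eq_Gamma) (simp add: B_def entry_simps)
  also have "gram1 B (xpows 1 (n + 1)) = det (\<Gamma> p (n + 1))"
    by (rule gram_eq_Gamma) (simp add: B_def entry_simps)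
  also have "gram1 B (map w [0..<n]) = (-1) ^ n * det (\<Delta> p n)"
    unfolding \<Delta>_def by (rule gram_hankel) (simp add: B_def w_def q_def entry_simps)
  finally show "gram1 B (xpows 0 (n + 1) @ xpows 1 (n + 1) @ xpows 2 n)
      = (-1) ^ n * (det (\<Gamma> p (n + 1)))\<^sup>2 * det (\<Delta> p n)"
    by (simp add: power2_eq_square)
qed

lemma Gamma_1_grams:
  fixes p n m :: nat
  defines "B \<equiv> hankel_form cantor p 1"
  shows "gram1 B (xpows 0 (Suc m) @ xpows 1 (Suc m) @ xpows 2 (Suc m))
      = det (\<Gamma> (p + 1) (Suc m)) * block_pair p m"
    and "gram1 B (xpows 0 (Suc m + 1) @ xpows 1 (Suc m) @ xpows 2 (Suc m))
      = (-1) ^ m * (det (\<Gamma> p (Suc m + 1)))\<^sup>2 * det (\<Delta> (p + 1) m)"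
    and "gram1 B (xpows 0 (n + 1) @ xpows 1 (n + 1) @ xpows 2 n)
      = (-1) ^ (n + 1) * (det (\<Gamma> p (n + 1)))\<^sup>2 * det (\<Delta> (p + 1) n)"
proof -
  have sym: "B x y = B y x" for x y unfolding B_def by (rule hankel_form.sym)
  \<comment> \<open>The blocks of residues (0, 2) and (2, 2) agree, so \<open>v a\<close> is
    orthogonal to the family \<open>xpow 2\<close>.\<close>
  define v where "v a = xpow 0 a - xpow 2 a" for a
  have "gram1 B (xpows 0 (Suc m) @ xpows 1 (Suc m) @ xpows 2 (Suc m))
      = gram1 B ((xpows 2 (Suc m) @ xpows 1 (Suc m)) @ xpows 0 (Suc m))"
    by (rule gram_permute) (simp add: add.commute)
  also have "\<dots> = gram1 B ((xpows 2 (Suc m) @ xpows 1 (Suc m)) @ map v [0..<Suc m])"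
    unfolding B_def by (rule hankel_form.gram_shift) (auto simp: v_def)
  also have "\<dots> = gram1 B (xpows 2 (Suc m) @ (xpows 1 (Suc m) @ map v [0..<Suc m]))"
    by simp
  also have "\<dots> = gram1 B (xpows 2 (Suc m)) * gram1 B (xpows 1 (Suc m) @ map v [0..<Suc m])"
    unfolding B_def by (rule hankel_form.gram_orthogonal) (auto simp: v_def entry_simps)
  also have "gram1 B (xpows 2 (Suc m)) = det (\<Gamma> (p + 1) (Suc m))"
    by (rule gram_eq_Gamma) (simp add: B_def entry_simps)
  also have "gram1 B (xpows 1 (Suc m) @ map v [0..<Suc m]) = block_pair p m"
    by (rule gram_block_pair_rotated)
      (simp_all add: B_def v_def entry_simps hankel_form.symmetric_biadditive_axioms)
  finally show "gram1 B (xpows 0 (Suc m) @ xpows 1 (Suc m) @ xpows 2 (Suc m))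
      = det (\<Gamma> (p + 1) (Suc m)) * block_pair p m" .

  \<comment> \<open>Against the isotropic family \<open>xpow 0\<close>, the vectors
    \<open>xpow 2 a\<close> and \<open>xpow 1 (Suc a)\<close> have equal products, so
    \<open>t a\<close> is orthogonal to it.\<close>
  define t where "t a = xpow 2 a - xpow 1 (Suc a)" for a
  have T: "gram1 B (map t [0..<k]) = det (\<Delta> (p + 1) k)" for k
    by (rule gram_eq_Delta) (simp add: B_def t_def entry_simps)

  \<comment> \<open>Since \<open>xpow 1 (Suc m)\<close> is absent, \<open>xpow 2 m\<close> cannot be
    corrected. It takes its place instead: both have the same products with the family
    \<open>xpow 0\<close>, so the pairing is a full Hankel matrix of order
    \<open>Suc m + 1\<close>.\<close>
  define y where "y b = (if b < Suc m then xpow 1 b else xpow 2 m)" for b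
  have y: "xpows 1 (Suc m) @ [xpow 2 m] = map y [0..<Suc m + 1]"
    by (simp add: y_def)
  have "gram1 B (xpows 0 (Suc m + 1) @ xpows 1 (Suc m) @ xpows 2 (Suc m)) 
      = gram1 B ((xpows 0 (Suc m + 1) @ xpows 1 (Suc m) @ [xpow 2 m]) @ xpows 2 m)"
    by (rule gram_permute) simp
  also have "\<dots>
      = gram1 B ((xpows 0 (Suc m + 1) @ xpows 1 (Suc m) @ [xpow 2 m]) @ map t [0..<m])"
    unfolding B_def by (rule hankel_form.gram_shift) (auto simp: t_def bex_Un simp del: upt_Suc)
  also have "\<dots>
      = gram1 B (xpows 0 (Suc m + 1) @ (xpows 1 (Suc m) @ [xpow 2 m]) @ map t [0..<m])"
    by simp
  also have "\<dots>
      = (-1) ^ (Suc m + 1) * (gram B (xpows 0 (Suc m + 1)) (xpows 1 (Suc m) @ [xpow 2 m]))\<^sup>2 * gram1 B (map t [0..<m])"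
    by (rule gram_anti_block[OF sym]) (auto simp: B_def t_def entry_simps)
  also have "gram B (xpows 0 (Suc m + 1)) (xpows 1 (Suc m) @ [xpow 2 m])
      = 1 ^ (Suc m + 1) * det (\<Gamma> p (Suc m + 1))"
    unfolding y \<Gamma>_def
    by (rule gram_hankel) (auto simp: B_def y_def entry_simps less_Suc_eq)
  finally show "gram1 B (xpows 0 (Suc m + 1) @ xpows 1 (Suc m) @ xpows 2 (Suc m))
      = (-1) ^ m * (det (\<Gamma> p (Suc m + 1)))\<^sup>2 * det (\<Delta> (p + 1) m)"
    by (simp add: T)

  have "gram1 B (xpows 0 (n + 1) @ xpows 1 (n + 1) @ xpows 2 n)
      = gram1 B ((xpows 0 (n + 1) @ xpows 1 (n + 1)) @ xpows 2 n)"
    by simp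
  also have "\<dots> = gram1 B ((xpows 0 (n + 1) @ xpows 1 (n + 1)) @ map t [0..<n])"
    unfolding B_def by (rule hankel_form.gram_shift) (auto simp: t_def bex_Un simp del: upt_Suc)
  also have "\<dots> = gram1 B (xpows 0 (n + 1) @ xpows 1 (n + 1) @ map t [0..<n])" by simp
  also have "\<dots>
      = (-1) ^ (n + 1) * (gram B (xpows 0 (n + 1)) (xpows 1 (n + 1)))\<^sup>2 * gram1 B (map t [0..<n])"
    by (rule gram_anti_block[OF sym]) (auto simp: B_def t_def entry_simps)
  also have "gram B (xpows 0 (n + 1)) (xpows 1 (n + 1)) = det (\<Gamma> p (n + 1))"
    by (rule gram_eq_Gamma) (simp add: B_def entry_simps)
  finally show "gram1 B (xpows 0 (n + 1) @ xpows 1 (n + 1) @ xpows 2 n)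
      = (-1) ^ (n + 1) * (det (\<Gamma> p (n + 1)))\<^sup>2 * det (\<Delta> (p + 1) n)"
    by (simp add: T)
qed

lemma Gamma_2_grams:
  fixes p n m :: nat
  defines "B \<equiv> hankel_form cantor p 2"
  shows "gram1 B (xpows 0 n @ xpows 1 n @ xpows 2 n)
      = (-1) ^ n * (det (\<Gamma> (p + 1) n))\<^sup>2 * det (\<Delta> p n)"
    and "gram1 B (xpows 0 (Suc m + 1) @ xpows 1 (Suc m) @ xpows 2 (Suc m))
        = det (\<Gamma> p (Suc m + 1)) * block_pair (p + 1) m"
    and "gram1 B (xpows 0 (n + 1) @ xpows 1 (n + 1) @ xpows 2 n)
        = (-1) ^ (n + 1) * (det (\<Gamma> (p + 1) (n + 1)))\<^sup>2 * det (\<Delta> p n)"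
proof -
  have sym: "B x y = B y x" for x y unfolding B_def by (rule hankel_form.sym)
  \<comment> \<open>Now residue 1 is isotropic and pairs equally with residues 0 and 2, so
    \<open>v a\<close> is orthogonal to it.\<close>
  define v where "v a = xpow 0 a - xpow 2 a" for a
  have "gram1 B (xpows 0 n @ xpows 1 n @ xpows 2 n) = gram1 B ((xpows 1 n @ xpows 2 n) @ xpows 0 n)"
    by (rule gram_permute) (simp add: ac_simps)
  also have "\<dots> = gram1 B ((xpows 1 n @ xpows 2 n) @ map v [0..<n])"
    unfolding B_def by (rule hankel_form.gram_shift) (auto simp: v_def bex_Un simp del: upt_Suc)
  also have "\<dots> = gram1 B (xpows 1 n @ xpows 2 n @ map v [0..<n])"
    by simp
  also have "\<dots>
      = (-1) ^ n * (gram B (xpows 1 n) (xpows 2 n))\<^sup>2 * gram1 B (map v [0..<n])"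
    by (rule gram_anti_block[OF sym]) (auto simp: B_def v_def entry_simps)
  also have "gram B (xpows 1 n) (xpows 2 n) = det (\<Gamma> (p + 1) n)"
    by (rule gram_eq_Gamma) (simp add: B_def entry_simps)
  also have "gram1 B (map v [0..<n]) = det (\<Delta> p n)"
    by (rule gram_eq_Delta) (simp add: B_def v_def entry_simps)
  finally show "gram1 B (xpows 0 n @ xpows 1 n @ xpows 2 n)
      = (-1) ^ n * (det (\<Gamma> (p + 1) n))\<^sup>2 * det (\<Delta> p n)" .

  \<comment> \<open>This makes \<open>r a\<close> orthogonal to the family \<open>xpow 0\<close>;
    the extra member of residue 0 is what covers \<open>a = m\<close>.\<close>
  define r where "r a = xpow 1 a - xpow 0 (Suc a)" for a
  have "gram1 B (xpows 0 (Suc m + 1) @ xpows 1 (Suc m) @ xpows 2 (Suc m))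
      = gram1 B ((xpows 0 (Suc m + 1) @ xpows 2 (Suc m)) @ xpows 1 (Suc m))"
    by (rule gram_permute) (simp add: ac_simps)
  also have "\<dots> = gram1 B ((xpows 0 (Suc m + 1) @ xpows 2 (Suc m)) @ map r [0..<Suc m])"
    unfolding B_def by (rule hankel_form.gram_shift) (auto simp: r_def bex_Un simp del: upt_Suc)
  also have "\<dots> = gram1 B (xpows 0 (Suc m + 1) @ (xpows 2 (Suc m) @ map r [0..<Suc m]))"
    by simp
  also have "\<dots>
      = gram1 B (xpows 0 (Suc m + 1)) * gram1 B (xpows 2 (Suc m) @ map r [0..<Suc m])"
    unfolding B_def by (rule hankel_form.gram_orthogonal) (auto simp: r_def entry_simps)
  also have "gram1 B (xpows 0 (Suc m + 1)) = det (\<Gamma> p (Suc m + 1))"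
    by (rule gram_eq_Gamma) (simp add: B_def entry_simps)
  also have "gram1 B (xpows 2 (Suc m) @ map r [0..<Suc m]) = block_pair (p + 1) m"
    by (rule gram_block_pair_rotated)
      (simp_all add: B_def r_def entry_simps hankel_form.symmetric_biadditive_axioms)
  finally show "gram1 B (xpows 0 (Suc m + 1) @ xpows 1 (Suc m) @ xpows 2 (Suc m))
      = det (\<Gamma> p (Suc m + 1)) * block_pair (p + 1) m" .

  \<comment> \<open>The unmatched \<open>xpow 0 n\<close> acts as the missing
    \<open>xpow 2 n\<close> in products with the family \<open>xpow 1\<close>.\<close>
  define y where "y b = (if b < n then xpow 2 b else xpow 0 n)" for b
  have y: "xpows 2 n @ [xpow 0 n] = map y [0..<n + 1]"
    by (simp add: y_def)
  have "gram1 B (xpows 0 (n + 1) @ xpows 1 (n + 1) @ xpows 2 n)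
      = gram1 B ((xpows 1 (n + 1) @ xpows 2 n @ [xpow 0 n]) @ xpows 0 n)"
    by (rule gram_permute) (simp add: ac_simps)
  also have "\<dots> = gram1 B ((xpows 1 (n + 1) @ xpows 2 n @ [xpow 0 n]) @ map v [0..<n])"
    unfolding B_def by (rule hankel_form.gram_shift) (auto simp: v_def bex_Un simp del: upt_Suc)
  also have "\<dots> = gram1 B (xpows 1 (n + 1) @ (xpows 2 n @ [xpow 0 n]) @ map v [0..<n])"
    by simp
  also have "\<dots>
      = (-1) ^ (n + 1) * (gram B (xpows 1 (n + 1)) (xpows 2 n @ [xpow 0 n]))\<^sup>2 * gram1 B (map v [0..<n])"
    by (rule gram_anti_block[OF sym]) (auto simp: B_def v_def entry_simps)
  also have "gram B (xpows 1 (n + 1)) (xpows 2 n @ [xpow 0 n])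
      = 1 ^ (n + 1) * det (\<Gamma> (p + 1) (n + 1))"
    unfolding y \<Gamma>_def by (rule gram_hankel) (auto simp: B_def y_def entry_simps less_Suc_eq)
  also have "gram1 B (map v [0..<n]) = det (\<Delta> p n)"
    by (rule gram_eq_Delta) (simp add: B_def v_def entry_simps)
  finally show "gram1 B (xpows 0 (n + 1) @ xpows 1 (n + 1) @ xpows 2 n)
      = (-1) ^ (n + 1) * (det (\<Gamma> (p + 1) (n + 1)))\<^sup>2 * det (\<Delta> p n)"
    by simp
qed

section \<open>Gram determinants of the sequence congruent to d, for the three residues\<close>

lemma Delta_0_grams:
  fixes p n m :: nat
  defines "B \<equiv> hankel_form d_mod3 p 0"
  shows "gram1 B (xpows 0 (Suc m) @ xpows 1 (Suc m) @ xpows 2 (Suc m))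
      = block_pair p m * det (\<Delta> p (Suc m))"
    and "gram1 B (xpows 0 (n + 1) @ xpows 1 n @ xpows 2 n)
        = (-1) ^ (n + 1) * det (\<Gamma> p (n + 1)) * (det (\<Delta> p n))\<^sup>2"
    and "gram1 B (xpows 0 (n + 1) @ xpows 1 (n + 1) @ xpows 2 n)
        = block_pair p n * det (\<Delta> p n)"
proof -
  \<comment> \<open>The sign chosen in \<open>d_mod3\<close> makes \<open>u a\<close> orthogonal to
    residues 0 and 1 alike, so a factor from \<open>d_seq\<close> splits off.\<close>
  define u where "u a = xpow 2 a + xpow 0 a" for a
  have split: "gram1 B (xpows 0 k @ xpows 1 l @ xpows 2 j)
      = gram1 B (xpows 0 k @ xpows 1 l) * det (\<Delta> p j)"
    if "j \<le> k" for j k l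
  proof -
    have "gram1 B ((xpows 0 k @ xpows 1 l) @ xpows 2 j)
        = gram1 B ((xpows 0 k @ xpows 1 l) @ map u [0..<j])"
      unfolding B_def by (rule hankel_form.gram_shift) (use that in \<open>auto simp: u_def\<close>)
    also have "\<dots> = gram1 B (xpows 0 k @ xpows 1 l) * gram1 B (map u [0..<j])"
      unfolding B_def by (rule hankel_form.gram_orthogonal) (auto simp: u_def entry_simps)
    also have "gram1 B (map u [0..<j]) = det (\<Delta> p j)"
      by (rule gram_eq_Delta) (simp add: B_def u_def entry_simps)
    finally show ?thesis by simp
  qed
  have pair: "gram1 B (xpows 0 (Suc k) @ xpows 1 (Suc k)) = block_pair p k" for k
  proof -
    have "gram1 B (xpows 0 (Suc k) @ xpows 1 (Suc k)) = gram1 B (xpows 1 (Suc k) @ xpows 0 (Suc k))"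
      by (rule gram_permute) simp
    also have "\<dots> = block_pair p k"
      by (rule gram_block_pair) (simp_all add: B_def entry_simps)
    finally show ?thesis .
  qed
  show "gram1 B (xpows 0 (Suc m) @ xpows 1 (Suc m) @ xpows 2 (Suc m))
      = block_pair p m * det (\<Delta> p (Suc m))"
    by (subst split) (simp_all only: pair order.refl)
  show "gram1 B (xpows 0 (n + 1) @ xpows 1 (n + 1) @ xpows 2 n)
      = block_pair p n * det (\<Delta> p n)"
    using split[of n "n + 1" "n + 1"] pair[of n] by (simp del: upt_Suc)

  define x where "x a = xpow 1 a + xpow 0 (Suc a)" for a
  have "gram1 B (xpows 0 (n + 1) @ xpows 1 n @ xpows 2 n)
      = gram1 B (xpows 0 (n + 1) @ xpows 1 n) * det (\<Delta> p n)"
    by (rule split) simp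
  also have "gram1 B (xpows 0 (n + 1) @ xpows 1 n) = gram1 B (xpows 0 (n + 1) @ map x [0..<n])"
    unfolding B_def by (rule hankel_form.gram_shift) (auto simp: x_def bex_Un simp del: upt_Suc)
  also have "gram1 B (xpows 0 (n + 1) @ map x [0..<n])
      = gram1 B (xpows 0 (n + 1)) * gram1 B (map x [0..<n])"
    unfolding B_def by (rule hankel_form.gram_orthogonal) (auto simp: x_def entry_simps)
  also have "gram1 B (map x [0..<n]) = det (\<Delta> p n)"
    by (rule gram_eq_Delta) (simp add: B_def x_def entry_simps)
  also have "gram1 B (xpows 0 (n + 1)) = (-1) ^ (n + 1) * det (\<Gamma> p (n + 1))"
    unfolding \<Gamma>_def by (rule gram_hankel) (auto simp: B_def entry_simps less_Suc_eq)
  finally show "gram1 B (xpows 0 (n + 1) @ xpows 1 n @ xpows 2 n)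
      = (-1) ^ (n + 1) * det (\<Gamma> p (n + 1)) * (det (\<Delta> p n))\<^sup>2"
    by (simp add: power2_eq_square)
qed

lemma Delta_1_grams:
  fixes p n m :: nat
  defines "B \<equiv> hankel_form d_mod3 p 1"
  shows "\<And>k. n \<le> k \<Longrightarrow> gram1 B (xpows 0 k @ xpows 1 n @ xpows 2 n)
      = (-1) ^ n * det (\<Gamma> (p + 1) k) * (det (\<Delta> p n))\<^sup>2"
    and "gram1 B (xpows 0 (n + 1) @ xpows 1 (n + 1) @ xpows 2 n)
        = block_pair p n * det (\<Delta> (p + 1) n)"
proof -
  have sym: "B x y = B y x" for x y unfolding B_def by (rule hankel_form.sym)
  \<comment> \<open>For this offset the vectors \<open>u a\<close> are isotropic and orthogonal to
    the family \<open>xpow 0\<close>; their pairing with residue 1 is the Hankel matrix of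
    \<open>d_seq\<close>.\<close>
  define u where "u a = xpow 2 a + xpow 0 a" for a
  show "gram1 B (xpows 0 k @ xpows 1 n @ xpows 2 n)
      = (-1) ^ n * det (\<Gamma> (p + 1) k) * (det (\<Delta> p n))\<^sup>2" if "n \<le> k" for k
  proof -
    have "gram1 B (xpows 0 k @ xpows 1 n @ xpows 2 n)
        = gram1 B ((xpows 0 k @ xpows 1 n) @ xpows 2 n)"
      by simp
    also have "\<dots> = gram1 B ((xpows 0 k @ xpows 1 n) @ map u [0..<n])"
      unfolding B_def by (rule hankel_form.gram_shift) (use that in \<open>auto simp: u_def\<close>)
    also have "\<dots> = gram1 B (map u [0..<n] @ xpows 1 n @ xpows 0 k)"
      by (rule gram_permute) (simp add: ac_simps)
    also have "\<dots>
        = (-1) ^ n * (gram B (map u [0..<n]) (xpows 1 n))\<^sup>2 * gram1 B (xpows 0 k)"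
      by (rule gram_anti_block[OF sym]) (auto simp: B_def u_def entry_simps)
    also have "gram B (map u [0..<n]) (xpows 1 n) = det (\<Delta> p n)"
      by (rule gram_eq_Delta) (simp add: B_def u_def entry_simps)
    also have "gram1 B (xpows 0 k) = det (\<Gamma> (p + 1) k)"
      by (rule gram_eq_Gamma) (simp add: B_def entry_simps)
    finally show ?thesis by simp
  qed

  \<comment> \<open>The extra member of residue 1 provides \<open>xpow 1 (Suc a)\<close> for all
    \<open>a < n\<close>; then \<open>t a\<close> is orthogonal to residues 0 and 1.\<close>
  define t where "t a = xpow 2 a + xpow 1 (Suc a)" for a
  have "gram1 B (xpows 0 (n + 1) @ xpows 1 (n + 1) @ xpows 2 n)
      = gram1 B ((xpows 0 (n + 1) @ xpows 1 (n + 1)) @ xpows 2 n)"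
    by simp
  also have "\<dots> = gram1 B ((xpows 0 (n + 1) @ xpows 1 (n + 1)) @ map t [0..<n])"
    unfolding B_def by (rule hankel_form.gram_shift) (auto simp: t_def bex_Un simp del: upt_Suc)
  also have "\<dots> = gram1 B (xpows 0 (n + 1) @ xpows 1 (n + 1)) * gram1 B (map t [0..<n])"
    unfolding B_def by (rule hankel_form.gram_orthogonal) (auto simp: t_def entry_simps)
  also have "gram1 B (map t [0..<n]) = det (\<Delta> (p + 1) n)"
    by (rule gram_eq_Delta) (simp add: B_def t_def entry_simps)
  also have "gram1 B (xpows 0 (n + 1) @ xpows 1 (n + 1)) = block_pair p n"
    unfolding Suc_eq_plus1[symmetric] by (rule gram_block_pair_rotated)
      (simp_all add: B_def entry_simps hankel_form.symmetric_biadditive_axioms)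
  finally show "gram1 B (xpows 0 (n + 1) @ xpows 1 (n + 1) @ xpows 2 n)
      = block_pair p n * det (\<Delta> (p + 1) n)" .
qed

lemma Delta_2_grams:
  fixes p n m :: nat
  defines "B \<equiv> hankel_form d_mod3 p 2"
  shows "gram1 B (xpows 0 (Suc m) @ xpows 1 (Suc m) @ xpows 2 (Suc m))
      = block_pair (p + 1) m * det (\<Delta> p (Suc m))"
    and "gram1 B (xpows 0 (n + 1) @ xpows 1 n @ xpows 2 n)
        = (-1) ^ n * det (\<Gamma> p (n + 1)) * (det (\<Delta> (p + 1) n))\<^sup>2"
    and "gram1 B (xpows 0 (n + 1) @ xpows 1 (n + 1) @ xpows 2 n)
        = (-1) ^ n * det (\<Gamma> p (n + 2)) * (det (\<Delta> (p + 1) n))\<^sup>2"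
proof -
  have sym: "B x y = B y x" for x y unfolding B_def by (rule hankel_form.sym)
  define v where "v a = xpow 0 a + xpow 2 a" for a
  have "gram1 B (xpows 0 (Suc m) @ xpows 1 (Suc m) @ xpows 2 (Suc m))
      = gram1 B ((xpows 1 (Suc m) @ xpows 2 (Suc m)) @ xpows 0 (Suc m))"
    by (rule gram_permute) (simp add: ac_simps)
  also have "\<dots> = gram1 B ((xpows 1 (Suc m) @ xpows 2 (Suc m)) @ map v [0..<Suc m])"
    unfolding B_def by (rule hankel_form.gram_shift) (auto simp: v_def bex_Un simp del: upt_Suc)
  also have "\<dots> = gram1 B (xpows 1 (Suc m) @ xpows 2 (Suc m)) * gram1 B (map v [0..<Suc m])"
    unfolding B_def by (rule hankel_form.gram_orthogonal) (auto simp: v_def entry_simps)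
  also have "gram1 B (map v [0..<Suc m]) = det (\<Delta> p (Suc m))"
    by (rule gram_eq_Delta) (simp add: B_def v_def entry_simps)
  also have "gram1 B (xpows 1 (Suc m) @ xpows 2 (Suc m)) = block_pair (p + 1) m"
    by (rule gram_block_pair_rotated)
      (simp_all add: B_def entry_simps hankel_form.symmetric_biadditive_axioms)
  finally show "gram1 B (xpows 0 (Suc m) @ xpows 1 (Suc m) @ xpows 2 (Suc m))
      = block_pair (p + 1) m * det (\<Delta> p (Suc m))" .

  \<comment> \<open>The vectors \<open>x a\<close> are isotropic and orthogonal to residues 0 and 1,
    and pair with residue 2 to a Hankel matrix of \<open>d_seq\<close>.\<close>
  define x where "x a = xpow 1 a + xpow 0 (Suc a)" for a
  have X: "gram B (map x [0..<n]) (xpows 2 n) = det (\<Delta> (p + 1) n)"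
    by (rule gram_eq_Delta) (simp add: B_def x_def entry_simps)
  have "gram1 B (xpows 0 (n + 1) @ xpows 1 n @ xpows 2 n)
      = gram1 B ((xpows 0 (n + 1) @ xpows 2 n) @ xpows 1 n)"
    by (rule gram_permute) (simp add: ac_simps)
  also have "\<dots> = gram1 B ((xpows 0 (n + 1) @ xpows 2 n) @ map x [0..<n])"
    unfolding B_def by (rule hankel_form.gram_shift) (auto simp: x_def bex_Un simp del: upt_Suc)
  also have "\<dots> = gram1 B (map x [0..<n] @ xpows 2 n @ xpows 0 (n + 1))"
    by (rule gram_permute) (simp add: ac_simps)
  also have "\<dots>
      = (-1) ^ n * (gram B (map x [0..<n]) (xpows 2 n))\<^sup>2 * gram1 B (xpows 0 (n + 1))"
    by (rule gram_anti_block[OF sym]) (auto simp: B_def x_def entry_simps)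
  also have "gram1 B (xpows 0 (n + 1)) = det (\<Gamma> p (n + 1))"
    by (rule gram_eq_Gamma) (simp add: B_def entry_simps)
  finally show "gram1 B (xpows 0 (n + 1) @ xpows 1 n @ xpows 2 n)
      = (-1) ^ n * det (\<Gamma> p (n + 1)) * (det (\<Delta> (p + 1) n))\<^sup>2"
    by (simp add: X)

  \<comment> \<open>Up to sign the unmatched \<open>xpow 1 n\<close> behaves like
    \<open>xpow 0 (n + 1)\<close> towards residue 0 and itself, which raises the order of the Cantor
    matrix to \<open>n + 2\<close>.\<close>
  define y where "y b = (if b < n + 1 then xpow 0 b else - xpow 1 n)" for b
  have y: "xpows 0 (n + 1) @ [- xpow 1 n] = map y [0..<n + 2]"
    by (simp add: y_def)
  have "gram1 B (xpows 0 (n + 1) @ xpows 1 (n + 1) @ xpows 2 n)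
      = gram1 B ((xpows 0 (n + 1) @ xpows 2 n @ [xpow 1 n]) @ xpows 1 n)"
    by (rule gram_permute) (simp add: ac_simps)
  also have "\<dots> = gram1 B ((xpows 0 (n + 1) @ xpows 2 n @ [xpow 1 n]) @ map x [0..<n])"
    unfolding B_def by (rule hankel_form.gram_shift) (auto simp: x_def bex_Un simp del: upt_Suc)
  also have "\<dots> = gram1 B (map x [0..<n] @ xpows 2 n @ (xpows 0 (n + 1) @ [xpow 1 n]))"
    by (rule gram_permute) (simp add: ac_simps)
  also have "\<dots>
      = (-1) ^ n * (gram B (map x [0..<n]) (xpows 2 n))\<^sup>2 * gram1 B (xpows 0 (n + 1) @ [xpow 1 n])"
    by (rule gram_anti_block[OF sym]) (auto simp: B_def x_def entry_simps)
  also have "gram1 B (xpows 0 (n + 1) @ [xpow 1 n]) = gram1 B (xpows 0 (n + 1) @ [- xpow 1 n])"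
    unfolding B_def by (rule hankel_form.gram_minus[symmetric])
  also have "gram1 B (xpows 0 (n + 1) @ [- xpow 1 n]) = 1 ^ (n + 2) * det (\<Gamma> p (n + 2))"
    unfolding y \<Gamma>_def by (rule gram_hankel) (auto simp: B_def y_def entry_simps less_Suc_eq)
  finally show "gram1 B (xpows 0 (n + 1) @ xpows 1 (n + 1) @ xpows 2 n)
      = (-1) ^ n * det (\<Gamma> p (n + 2)) * (det (\<Delta> (p + 1) n))\<^sup>2"
    by (simp add: X)
qed

section \<open>The eighteen identities from the block evaluations\<close>

theorem theorem1:
  fixes p n :: nat
  assumes "n \<ge> 2"
  shows "
    (det (\<Gamma> (3 * p) (3 * n)) = (-1)^n * (det (\<Gamma> p n))^2 * det (\<Delta> p n)
       + (-1)^(n + 1) * det (\<Gamma> p n) * det (\<Gamma> p (n + 1)) * det (\<Delta> p (n - 1))) \<and>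
    (det (\<Gamma> (3 * p) (3 * n + 1)) = (-1)^n * det (\<Gamma> p n) * det (\<Gamma> p (n + 1)) * det (\<Delta> p n)
       + (-1)^(n + 1) * (det (\<Gamma> p (n + 1)))^2 * det (\<Delta> p (n - 1))) \<and>
    (det (\<Gamma> (3 * p) (3 * n + 2)) = (-1)^n * (det (\<Gamma> p (n + 1)))^2 * det (\<Delta> p n)) \<and>
    (det (\<Gamma> (3 * p + 1) (3 * n)) = (-1)^n * det (\<Gamma> p n) * det (\<Gamma> (p + 1) n) * det (\<Delta> p n)
       + (-1)^(n + 1) * det (\<Gamma> (p + 1) n) * det (\<Gamma> p (n + 1)) * det (\<Delta> p (n - 1))) \<and>
    (det (\<Gamma> (3 * p + 1) (3 * n + 1)) = (-1)^(n + 1) * (det (\<Gamma> p (n + 1)))^2 * det (\<Delta> (p + 1) (n - 1))) \<and>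
    (det (\<Gamma> (3 * p + 1) (3 * n + 2)) = (-1)^(n + 1) * (det (\<Gamma> p (n + 1)))^2 * det (\<Delta> (p + 1) n)) \<and>
    (det (\<Gamma> (3 * p + 2) (3 * n)) = (-1)^n * (det (\<Gamma> (p + 1) n))^2 * det (\<Delta> p n)) \<and>
    (det (\<Gamma> (3 * p + 2) (3 * n + 1)) = (-1)^n * det (\<Gamma> (p + 1) n) * det (\<Gamma> p (n + 1)) * det (\<Delta> (p + 1) n)
       + (-1)^(n + 1) * det (\<Gamma> p (n + 1)) * det (\<Gamma> (p + 1) (n + 1)) * det (\<Delta> (p + 1) (n - 1))) \<and>
    (det (\<Gamma> (3 * p + 2) (3 * n + 2)) = (-1)^(n + 1) * (det (\<Gamma> (p + 1) (n + 1)))^2 * det (\<Delta> p n)) \<and>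
    ([det (\<Delta> (3 * p) (3 * n)) = (-1)^n * det (\<Gamma> p n) * (det (\<Delta> p n))^2
       + (-1)^(n + 1) * det (\<Gamma> p (n + 1)) * det (\<Delta> p (n - 1)) * det (\<Delta> p n)] (mod 3)) \<and>
    ([det (\<Delta> (3 * p) (3 * n + 1)) = (-1)^(n + 1) * det (\<Gamma> p (n + 1)) * (det (\<Delta> p n))^2] (mod 3)) \<and>
    ([det (\<Delta> (3 * p) (3 * n + 2)) = (-1)^n * det (\<Gamma> p (n + 2)) * (det (\<Delta> p n))^2
       + (-1)^(n + 1) * det (\<Gamma> p (n + 1)) * det (\<Delta> p n) * det (\<Delta> p (n + 1))] (mod 3)) \<and>
    ([det (\<Delta> (3 * p + 1) (3 * n)) = (-1)^n * det (\<Gamma> (p + 1) n) * (det (\<Delta> p n))^2] (mod 3)) \<and>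
    ([det (\<Delta> (3 * p + 1) (3 * n + 1)) = (-1)^n * det (\<Gamma> (p + 1) (n + 1)) * (det (\<Delta> p n))^2] (mod 3)) \<and>
    ([det (\<Delta> (3 * p + 1) (3 * n + 2)) = (-1)^n * det (\<Gamma> p (n + 2)) * det (\<Delta> p n) * det (\<Delta> (p + 1) n)
       + (-1)^(n + 1) * det (\<Gamma> p (n + 1)) * det (\<Delta> (p + 1) n) * det (\<Delta> p (n + 1))] (mod 3)) \<and>
    ([det (\<Delta> (3 * p + 2) (3 * n)) = (-1)^n * det (\<Gamma> (p + 1) n) * det (\<Delta> p n) * det (\<Delta> (p + 1) n)
       + (-1)^(n + 1) * det (\<Gamma> (p + 1) (n + 1)) * det (\<Delta> p n) * det (\<Delta> (p + 1) (n - 1))] (mod 3)) \<and>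
    ([det (\<Delta> (3 * p + 2) (3 * n + 1)) = (-1)^n * det (\<Gamma> p (n + 1)) * (det (\<Delta> (p + 1) n))^2] (mod 3)) \<and>
    ([det (\<Delta> (3 * p + 2) (3 * n + 2)) = (-1)^n * det (\<Gamma> p (n + 2)) * (det (\<Delta> (p + 1) n))^2] (mod 3))"
proof -
  from assms obtain m where m: "n = Suc m" by (metis Suc_le_D numeral_2_eq_2)
  have cong: "[det (\<Delta> (3 * p + k) N) = det (hankel d_mod3 (3 * p + k) N)] (mod 3)" for k N
    unfolding \<Delta>_def by (rule det_hankel_cong) (rule d_seq_cong_d_mod3)
  have G: "det (\<Gamma> (3 * p + k) N) = det (hankel cantor (3 * p + k) N)" for k N
    by (simp add: \<Gamma>_def)
  have g: "det (\<Gamma> (3 * p + k) (3 * n))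
      = gram1 (hankel_form cantor p k) (xpows 0 n @ xpows 1 n @ xpows 2 n)"
    "det (\<Gamma> (3 * p + k) (3 * n + 1)) = gram1 (hankel_form cantor p k) (xpows 0 (n + 1) @ xpows 1 n @ xpows 2 n)"
    "det (\<Gamma> (3 * p + k) (3 * n + 2)) = gram1 (hankel_form cantor p k) (xpows 0 (n + 1) @ xpows 1 (n + 1) @ xpows 2 n)"
    for k unfolding G hankel_blocks by simp_all
  have d: "[det (\<Delta> (3 * p + k) (3 * n))
      = gram1 (hankel_form d_mod3 p k) (xpows 0 n @ xpows 1 n @ xpows 2 n)] (mod 3)"
    "[det (\<Delta> (3 * p + k) (3 * n + 1)) = gram1 (hankel_form d_mod3 p k) (xpows 0 (n + 1) @ xpows 1 n @ xpows 2 n)] (mod 3)"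
    "[det (\<Delta> (3 * p + k) (3 * n + 2)) = gram1 (hankel_form d_mod3 p k) (xpows 0 (n + 1) @ xpows 1 (n + 1) @ xpows 2 n)] (mod 3)"
    for k using cong[of k] unfolding hankel_blocks[symmetric] by simp_all
  \<comment> \<open>The second argument of \<open>block_pair\<close> is one less than the order of
    its blocks: \<open>m\<close> serves blocks of order \<open>n\<close>, and \<open>n\<close> those
    of order \<open>n + 1\<close>.\<close>
  have pair: "block_pair q m
      = (-1) ^ n * (det (\<Gamma> q n) * det (\<Delta> q n) - det (\<Gamma> q (n + 1)) * det (\<Delta> q (n - 1)))" for q
    by (simp add: block_pair_def m)
  have pair': "block_pair q n
      = (-1) ^ (n + 1) * (det (\<Gamma> q (n + 1)) * det (\<Delta> q (n + 1)) - det (\<Gamma> q (n + 2)) * det (\<Delta> q n))" for q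
    by (simp add: block_pair_def)
  note Gamma_eqs =
    g(1)[of 0, unfolded Gamma_0_grams(1)[where n = n and m = m and p = p, folded m, OF order.refl]]
    g(2)[of 0, unfolded Gamma_0_grams(1)[where n = "n + 1" and m = m and p = p, folded m, OF le_add1]]
    g(3)[of 0, unfolded Gamma_0_grams(2)]
    g(1)[of 1, unfolded Gamma_1_grams(1)[where m = m and p = p, folded m]]
    g(2)[of 1, unfolded Gamma_1_grams(2)[where m = m and p = p, folded m]]
    g(3)[of 1, unfolded Gamma_1_grams(3)]
    g(1)[of 2, unfolded Gamma_2_grams(1)]
    g(2)[of 2, unfolded Gamma_2_grams(2)[where m = m and p = p, folded m]]
    g(3)[of 2, unfolded Gamma_2_grams(3)]
  note Delta_congs =
    d(1)[of 0, unfolded Delta_0_grams(1)[where m = m and p = p, folded m]]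
    d(2)[of 0, unfolded Delta_0_grams(2)]
    d(3)[of 0, unfolded Delta_0_grams(3)]
    d(1)[of 1, unfolded Delta_1_grams(1)[OF order.refl]]
    d(2)[of 1, unfolded Delta_1_grams(1)[OF le_add1]]
    d(3)[of 1, unfolded Delta_1_grams(2)]
    d(1)[of 2, unfolded Delta_2_grams(1)[where m = m and p = p, folded m]]
    d(2)[of 2, unfolded Delta_2_grams(2)]
    d(3)[of 2, unfolded Delta_2_grams(3)]
  \<comment> \<open>The exponents \<open>m\<close> and \<open>n + 1\<close> differ by 2.\<close>
  have sign: "(-1 :: int) ^ m = (-1) ^ (n + 1)" and m': "m = n - 1" by (simp_all add: m)
  show ?thesis
    using Gamma_eqs Delta_congs unfolding pair pair' sign unfolding m'
    by (simp add: algebra_simps power2_eq_square)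
qed

end
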